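(* In the setting of the context, let the terms of the sequence $\{h_{i,i-1}\}_{i=1}^{\infty}$ of free parameters in the matrices $\mathcal{G}$ and $\mathcal{H}$ be assigned the values $$h_{2i,2i-1}=-c_{2i+1}\bar\alpha_i,\qquad h_{2i-1,2i-2}=c_{2i},\qquad i\ge1 .$$ Then, for $j\ge1$, with $\mathcal{G}_j,\mathcal{H}_j$ the leading principal $j\times j$ submatrices of $\mathcal{G},\mathcal{H}$, $$\vec\varrho_j=\big(\varphi_0,\varphi_1,\dots,\varphi_{j-1}\big)^T$$ (components evaluated at $\lambda$) is the eigenvector of the generalized eigenvalue problem $\mathcal{G}_j\vec\varrho_j=\lambda\,\mathcal{H}_j\vec\varrho_j$ corresponding to the eigenvalue $\lambda$ which is a zero of $r_j(\lambda)$.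
   Context: Let $\{\alpha_j\}_{j\ge1}$, $\{\beta_j\}_{j\ge1}$ be sequences in $\mathbb{C}\setminus\{0\}$ and $\beta_0:=0$. The rational functions $\varphi_j$ are the orthonormal functions (with respect to an inner product $\langle f,g\rangle=\mathfrak{L}(f g_* )$, $g_*(z)=\overline{g(1/\bar z)}$, given by a Hermitian positive-definite linear functional $\mathfrak{L}$) obtained by Gram–Schmidt from the functions $\mathfrak{u}_{2j}(z)=z^{2j}/\big(\prod_{k=1}^{j}(z-\alpha_k)\prod_{k=1}^{j}(1-z\bar\beta_k)\big)$, $\mathfrak{u}_{2j+1}(z)=\frac{z}{z-\alpha_{j+1}}\mathfrak{u}_{2j}(z)$, $j\ge0$. They have the form $\varphi_0=1$, $$\varphi_{2j}(z)=\frac{r_{2j}(z)}{\prod_{k=1}^{j}(z-\alpha_k)\prod_{k=1}^{j}(1-z\bar\beta_k)},\qquad \varphi_{2j+1}(z)=\frac{r_{2j+1}(z)}{\prod_{k=1}^{j+1}(z-\alpha_k)\prod_{k=1}^{j}(1-z\bar\beta_k)},$$ with polynomials $r_n$ of degree at most $n$, $r_0=1$, and there are constants $e_j,d_j\in\mathbb{C}$, $c_j\in\mathbb{C}\setminus\{0\}$ such that, for $n\ge0$ and with $\varphi_{-1}=r_{-1}:=0$ (so that no $\alpha_0$ is needed), $$r_{2n+1}(z)=[e_{2n+1}+d_{2n+1}(z-\beta_n)]r_{2n}(z)+c_{2n+1}(1-z\bar\alpha_n)(1-z\bar\beta_n)r_{2n-1}(z),$$ $$r_{2n+2}(z)=[e_{2n+2}+d_{2n+2}(1-z\bar\alpha_{n+1})]r_{2n+1}(z)+c_{2n+2}(z-\alpha_{n+1})(z-\beta_n)r_{2n}(z).$$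 Standing regularity assumptions: $r_{2n}(\alpha_n)\ne0$, $r_{2n}(1/\bar\beta_n)\ne0$, $r_{2n}(\beta_{n-1})\neq0$, $r_{2n}(1/\bar\alpha_n)\ne0$ for $n\ge1$; $r_{2n+1}(\alpha_{n+1})\ne0$, $r_{2n+1}(\beta_n)\ne0$ for $n\ge0$; $r_{2n+1}(1/\bar\beta_n)\ne0$, $r_{2n+1}(1/\bar\alpha_n)\ne0$ for $n\ge1$. Given arbitrary nonzero complex numbers $h_{i,i-1}$, $i\ge1$, set for $k\ge0$ $$g_{2k+1}=-\frac{c_{2k+2}}{h_{2k+1,2k}},\qquad g_{2k+2}=-\frac{c_{2k+3}\,\bar\beta_{k+1}}{h_{2k+2,2k+1}} .$$ $\mathcal{H}$ and $\mathcal{G}$ are the infinite tridiagonal matrices (rows and columns indexed from $0$) with entries, for $k\ge0$: Diagonal: $\mathcal{H}_{2k,2k}=d_{2k+1}$, $\mathcal{H}_{2k+1,2k+1}=-d_{2k+2}\bar\alpha_{k+1}$; $\mathcal{G}_{2k,2k}=-e_{2k+1}+\beta_k d_{2k+1}$, $\mathcal{G}_{2k+1,2k+1}=-e_{2k+2}-d_{2k+2}$. Superdiagonal: $\mathcal{H}_{i-1,i}=g_i$ for $i\ge1$; $\mathcal{G}_{2k,2k+1}=\alpha_{k+1}g_{2k+1}$, $\mathcal{G}_{2k+1,2k+2}=\bar\alpha_{k+1}g_{2k+2}$. Subdiagonal: $\mathcal{H}_{i,i-1}=h_{i,i-1}$ for $i\ge1$; $\mathcal{G}_{2k+1,2k}=h_{2k+1,2k}\beta_k$,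 $\mathcal{G}_{2k+2,2k+1}=h_{2k+2,2k+1}/\bar\alpha_{k+1}$.
   Formalization: The printed formulas for g_{2k+2} and G_{2k+1,2k+2} make the claim false for j≥3; here g_{2k+2}=-c_{2k+3}ᾱ_{k+1}β̄_{k+1}/h_{2k+2,2k+1} and G_{2k+1,2k+2}=g_{2k+2}/β̄_{k+1}. Also λ is assumed not to be a pole of φ_0,…,φ_{j-1}. *)

theory Defs
  imports
    "HOL-Computational_Algebra.Computational_Algebra"
    "Jordan_Normal_Form.Matrix"
begin

section \<open>Rational functions and the substar conjugate\<close>

type_synonym ratfun = "complex poly fract"

definition rf_scale :: "complex \<Rightarrow> ratfun \<Rightarrow> ratfun" where
  "rf_scale a f = Fract [:a:] 1 * f"

lemma vector_space_rf_scale: "vector_space rf_scale"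
proof unfold_locales
  fix a b :: complex and x y :: ratfun
  show "rf_scale a (x + y) = rf_scale a x + rf_scale a y"
    by (simp add: rf_scale_def algebra_simps)
  have "Fract [:a + b:] 1 = Fract [:a:] 1 + (Fract [:b:] 1 :: ratfun)"
    by simp
  then show "rf_scale (a + b) x = rf_scale a x + rf_scale b x"
    by (metis distrib_right rf_scale_def)
  have "Fract [:a:] 1 * (Fract [:b:] 1 :: ratfun) = Fract [:a * b:] 1"
    by (simp add: mult.commute)
  then show "rf_scale a (rf_scale b x) = rf_scale (a * b) x"
    by (metis mult.assoc rf_scale_def)
  show "rf_scale 1 x = x"
    by (simp add: rf_scale_def One_fract_def [symmetric] pCons_one)
qed

abbreviation rf_span :: "ratfun set \<Rightarrow> ratfun set" where
  "rf_span \<equiv> module.span rf_scale"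

text \<open>\<open>p\<^sub>*(z) = cnj (p (1 / cnj z))\<close> for a polynomial \<open>p\<close>, as a rational function in \<open>z\<close>;
  see \<open>poly_star_eval\<close>.\<close>

definition poly_star :: "complex poly \<Rightarrow> ratfun" where
  "poly_star p = Fract (reflect_poly (map_poly cnj p)) (monom 1 (degree p))"

lemma poly_star_eval:
  assumes "z \<noteq> 0"
  shows "poly (reflect_poly (map_poly cnj p)) z / poly (monom 1 (degree p)) z
    = cnj (poly p (1 / cnj z))"
proof -
  have "degree (map_poly cnj p) = degree p"
    by (simp add: degree_map_poly)
  with assms show ?thesis
    by (simp add: poly_reflect_poly_nz poly_monom field_simps)
qed

text \<open>\<open>f\<^sub>* = p\<^sub>* / q\<^sub>*\<close> for \<open>f = p / q\<close>; by \<open>rf_star_Fract\<close> the choice of \<open>p\<close> and \<open>q\<close>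
  does not matter.\<close>

definition rf_star :: "ratfun \<Rightarrow> ratfun" where
  "rf_star f = (THE g. \<exists>p q. q \<noteq> 0 \<and> f = Fract p q \<and> g = poly_star p / poly_star q)"

lemma map_poly_cnj_mult: "map_poly cnj (p * q) = map_poly cnj p * map_poly cnj q"
  by (simp add: poly_eq_poly_eq_iff [symmetric] fun_eq_iff)

lemma poly_star_0 [simp]: "poly_star 0 = 0"
  by (simp add: poly_star_def fract_collapse)

lemma poly_star_eq_0_iff: "poly_star p = 0 \<longleftrightarrow> p = 0"
  by (auto simp: poly_star_def Zero_fract_def eq_fract monom_eq_0_iff map_poly_eq_0_iff)

lemma poly_star_mult: "poly_star (p * q) = poly_star p * poly_star q"
proof (cases "p = 0 \<or> q = 0")
  case False
  then show ?thesis
    by (simp add: poly_star_def map_poly_cnj_mult reflect_poly_mult degree_mult_eq mult_monom)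
qed auto

lemma rf_star_Fract:
  assumes "q \<noteq> 0"
  shows "rf_star (Fract p q) = poly_star p / poly_star q"
  unfolding rf_star_def
proof (rule the_equality)
  show "\<exists>p' q'. q' \<noteq> 0 \<and> Fract p q = Fract p' q' \<and>
      poly_star p / poly_star q = poly_star p' / poly_star q'"
    using assms by blast
next
  fix g
  assume "\<exists>p' q'. q' \<noteq> 0 \<and> Fract p q = Fract p' q' \<and> g = poly_star p' / poly_star q'"
  then obtain p' q' where q': "q' \<noteq> 0" and eq: "Fract p q = Fract p' q'"
    and g: "g = poly_star p' / poly_star q'"
    by blast
  have "p * q' = p' * q"
    using eq assms q' by (simp add: eq_fract)
  then have "poly_star p * poly_star q' = poly_star p' * poly_star q"
    by (metis poly_star_mult)
  then show "g = poly_star p / poly_star q"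
    using assms q' g by (simp add: poly_star_eq_0_iff frac_eq_eq)
qed

section \<open>The functional and Gram-Schmidt\<close>

definition rf_inner :: "(ratfun \<Rightarrow> complex) \<Rightarrow> ratfun \<Rightarrow> ratfun \<Rightarrow> complex" where
  "rf_inner L f g = L (f * rf_star g)"

text \<open>The functional matters only on the span of the products \<open>f g\<^sub>*\<close> with \<open>f, g\<close> in the
  space \<open>V\<close>; its values elsewhere are unconstrained.\<close>

definition hermitian_pos_def :: "ratfun set \<Rightarrow> (ratfun \<Rightarrow> complex) \<Rightarrow> bool" where
  "hermitian_pos_def V L \<longleftrightarrow>
    (let R = rf_span {f * rf_star g |f g. f \<in> V \<and> g \<in> V} in
      (\<forall>f\<in>R. \<forall>g\<in>R. L (f + g) = L f + L g) \<and>
      (\<forall>a. \<forall>f\<in>R. L (rf_scale a f) = a * L f) \<and>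
      (\<forall>f\<in>R. L (rf_star f) = cnj (L f))) \<and>
    (\<forall>f\<in>V. f \<noteq> 0 \<longrightarrow> rf_inner L f f \<in> \<real> \<and> Re (rf_inner L f f) > 0)"

fun gram_schmidt_rf :: "(ratfun \<Rightarrow> complex) \<Rightarrow> (nat \<Rightarrow> ratfun) \<Rightarrow> nat \<Rightarrow> ratfun" where
  "gram_schmidt_rf L u n =
    (let v = u n - (\<Sum>i<n. rf_scale (rf_inner L (u n) (gram_schmidt_rf L u i))
                             (gram_schmidt_rf L u i))
     in rf_scale (1 / complex_of_real (sqrt (Re (rf_inner L v v)))) v)"

declare gram_schmidt_rf.simps [simp del]

section \<open>The orthogonal rational functions\<close>

text \<open>The common denominator of \<open>\<uu>\<^sub>n\<close> and \<open>\<phi>\<^sub>n\<close>. Since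
  \<open>\<uu>\<^sub>2\<^sub>j\<^sub>+\<^sub>1(z) = z / (z - \<alpha>\<^sub>j\<^sub>+\<^sub>1) \<uu>\<^sub>2\<^sub>j(z)\<close>, one has \<open>\<uu>\<^sub>n(z) = z\<^sup>n / orf_den n\<close> for both parities.\<close>

definition orf_den :: "(nat \<Rightarrow> complex) \<Rightarrow> (nat \<Rightarrow> complex) \<Rightarrow> nat \<Rightarrow> complex poly" where
  "orf_den \<alpha> \<beta> n =
    (\<Prod>k = 1..(n + 1) div 2. [:- \<alpha> k, 1:]) * (\<Prod>k = 1..n div 2. [:1, - cnj (\<beta> k):])"

definition orf_basis :: "(nat \<Rightarrow> complex) \<Rightarrow> (nat \<Rightarrow> complex) \<Rightarrow> nat \<Rightarrow> ratfun" where
  "orf_basis \<alpha> \<beta> n = Fract (monom 1 n) (orf_den \<alpha> \<beta> n)"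

text \<open>The value \<open>\<phi>\<^sub>n(z) = r\<^sub>n(z) / orf_den n (z)\<close>, meaningful where the denominator does not
  vanish.\<close>

definition orf_eval ::
    "(nat \<Rightarrow> complex) \<Rightarrow> (nat \<Rightarrow> complex) \<Rightarrow> (nat \<Rightarrow> complex poly) \<Rightarrow> nat \<Rightarrow> complex \<Rightarrow> complex"
  where "orf_eval \<alpha> \<beta> r n z = poly (r n) z / poly (orf_den \<alpha> \<beta> n) z"

text \<open>\<open>\<alpha> 0\<close> and \<open>c 0, d 0, e 0\<close> are dummies. The case distinction in \<open>rec_odd\<close> encodes
  \<open>r\<^sub>-\<^sub>1 = 0\<close>.\<close>

locale orf_setting =
  fixes \<alpha> \<beta> :: "nat \<Rightarrow> complex"
    and L :: "ratfun \<Rightarrow> complex"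
    and r :: "nat \<Rightarrow> complex poly"
    and e d c :: "nat \<Rightarrow> complex"
  assumes alpha_nz: "\<And>k. k \<ge> 1 \<Longrightarrow> \<alpha> k \<noteq> 0"
    and beta_nz: "\<And>k. k \<ge> 1 \<Longrightarrow> \<beta> k \<noteq> 0"
    and beta_0: "\<beta> 0 = 0"
    and functional: "hermitian_pos_def (rf_span (range (orf_basis \<alpha> \<beta>))) L"
    and degree_r: "\<And>n. degree (r n) \<le> n"
    and r_0: "r 0 = 1"
    and phi: "\<And>n. gram_schmidt_rf L (orf_basis \<alpha> \<beta>) n = Fract (r n) (orf_den \<alpha> \<beta> n)"
    and c_nz: "\<And>k. k \<ge> 1 \<Longrightarrow> c k \<noteq> 0"
    and rec_odd: "\<And>n z. poly (r (2*n+1)) z =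
        (e (2*n+1) + d (2*n+1) * (z - \<beta> n)) * poly (r (2*n)) z +
        (if n = 0 then 0
         else c (2*n+1) * (1 - z * cnj (\<alpha> n)) * (1 - z * cnj (\<beta> n)) * poly (r (2*n-1)) z)"
    and rec_even: "\<And>n z. poly (r (2*n+2)) z =
        (e (2*n+2) + d (2*n+2) * (1 - z * cnj (\<alpha> (n+1)))) * poly (r (2*n+1)) z +
        c (2*n+2) * (z - \<alpha> (n+1)) * (z - \<beta> n) * poly (r (2*n)) z"
    and reg_even: "\<And>n. n \<ge> 1 \<Longrightarrow>
        poly (r (2*n)) (\<alpha> n) \<noteq> 0 \<and> poly (r (2*n)) (1 / cnj (\<beta> n)) \<noteq> 0 \<and>
        poly (r (2*n)) (\<beta> (n-1)) \<noteq> 0 \<and> poly (r (2*n)) (1 / cnj (\<alpha> n)) \<noteq> 0"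
    and reg_odd: "\<And>n.
        poly (r (2*n+1)) (\<alpha> (n+1)) \<noteq> 0 \<and> poly (r (2*n+1)) (\<beta> n) \<noteq> 0"
    and reg_odd': "\<And>n. n \<ge> 1 \<Longrightarrow>
        poly (r (2*n+1)) (1 / cnj (\<beta> n)) \<noteq> 0 \<and> poly (r (2*n+1)) (1 / cnj (\<alpha> n)) \<noteq> 0"

section \<open>The matrix pencil\<close>

text \<open>
  In what follows \<open>h i\<close> stands for \<open>h\<^sub>i\<^sub>,\<^sub>i\<^sub>-\<^sub>1\<close>.

  Two formulas deviate from the source, which prints
  \<open>g\<^sub>2\<^sub>k\<^sub>+\<^sub>2 = - c\<^sub>2\<^sub>k\<^sub>+\<^sub>3 cnj \<beta>\<^sub>k\<^sub>+\<^sub>1 / h\<^sub>2\<^sub>k\<^sub>+\<^sub>2\<^sub>,\<^sub>2\<^sub>k\<^sub>+\<^sub>1\<close> and \<open>\<G>\<^sub>2\<^sub>k\<^sub>+\<^sub>1\<^sub>,\<^sub>2\<^sub>k\<^sub>+\<^sub>2 = cnj \<alpha>\<^sub>k\<^sub>+\<^sub>1 g\<^sub>2\<^sub>k\<^sub>+\<^sub>2\<close>. With these,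
  and \<open>h\<^sub>2\<^sub>k\<^sub>+\<^sub>2\<^sub>,\<^sub>2\<^sub>k\<^sub>+\<^sub>1 = - c\<^sub>2\<^sub>k\<^sub>+\<^sub>3 cnj \<alpha>\<^sub>k\<^sub>+\<^sub>1\<close>, the superdiagonal entry of \<open>\<G> - \<lambda>\<H>\<close> in row \<open>2k+1\<close> is
  \<open>cnj \<beta>\<^sub>k\<^sub>+\<^sub>1 (1 - \<lambda> / cnj \<alpha>\<^sub>k\<^sub>+\<^sub>1)\<close>, while the recurrence for \<open>r\<^sub>2\<^sub>k\<^sub>+\<^sub>2\<close>, divided by the common
  denominator, requires \<open>1 - \<lambda> cnj \<beta>\<^sub>k\<^sub>+\<^sub>1\<close>, so that \<open>(\<phi>\<^sub>0, \<dots>, \<phi>\<^sub>j\<^sub>-\<^sub>1)\<close> is in general not an eigenvector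
  once \<open>j \<ge> 3\<close>. The formulas below are the unique correction of this superdiagonal that makes it
  agree with the recurrence; equivalently, they give the off-diagonal products
  \<open>(\<G> - \<lambda>\<H>)\<^sub>i\<^sub>-\<^sub>1\<^sub>,\<^sub>i (\<G> - \<lambda>\<H>)\<^sub>i\<^sub>,\<^sub>i\<^sub>-\<^sub>1 = - c\<^sub>2\<^sub>k\<^sub>+\<^sub>3 (1 - \<lambda> cnj \<alpha>\<^sub>k\<^sub>+\<^sub>1) (1 - \<lambda> cnj \<beta>\<^sub>k\<^sub>+\<^sub>1)\<close>, \<open>i = 2k+2\<close>,
  for all \<open>h\<close>.
\<close>

definition pencil_g ::
    "(nat \<Rightarrow> complex) \<Rightarrow> (nat \<Rightarrow> complex) \<Rightarrow> (nat \<Rightarrow> complex) \<Rightarrow> (nat \<Rightarrow> complex) \<Rightarrow> nat \<Rightarrow> complex"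
  where "pencil_g \<alpha> \<beta> c h i =
    (if odd i then - c (i + 1) / h i
     else - c (i + 1) * cnj (\<alpha> (i div 2)) * cnj (\<beta> (i div 2)) / h i)"

definition pencil_H ::
    "(nat \<Rightarrow> complex) \<Rightarrow> (nat \<Rightarrow> complex) \<Rightarrow> (nat \<Rightarrow> complex) \<Rightarrow> (nat \<Rightarrow> complex) \<Rightarrow>
     (nat \<Rightarrow> complex) \<Rightarrow> nat \<Rightarrow> nat \<Rightarrow> complex"
  where "pencil_H \<alpha> \<beta> d c h i k =
    (if k = i then (if even i then d (i + 1) else - d (i + 1) * cnj (\<alpha> (i div 2 + 1)))
     else if k = i + 1 then pencil_g \<alpha> \<beta> c h k
     else if i = k + 1 then h i
     else 0)"

definition pencil_G ::
    "(nat \<Rightarrow> complex) \<Rightarrow> (nat \<Rightarrow> complex) \<Rightarrow> (nat \<Rightarrow> complex) \<Rightarrow> (nat \<Rightarrow> complex) \<Rightarrow>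
     (nat \<Rightarrow> complex) \<Rightarrow> (nat \<Rightarrow> complex) \<Rightarrow> nat \<Rightarrow> nat \<Rightarrow> complex"
  where "pencil_G \<alpha> \<beta> e d c h i k =
    (if k = i then
       (if even i then - e (i + 1) + \<beta> (i div 2) * d (i + 1) else - e (i + 1) - d (i + 1))
     else if k = i + 1 then
       (if even i then \<alpha> (i div 2 + 1) * pencil_g \<alpha> \<beta> c h k
        else pencil_g \<alpha> \<beta> c h k / cnj (\<beta> (i div 2 + 1)))
     else if i = k + 1 then
       (if odd i then h i * \<beta> (i div 2) else h i / cnj (\<alpha> (i div 2)))
     else 0)"

definition leading_principal :: "(nat \<Rightarrow> nat \<Rightarrow> complex) \<Rightarrow> nat \<Rightarrow> complex mat" where
  "leading_principal A j = mat j j (\<lambda>(i, k). A i k)"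

definition gen_eigenvector ::
    "complex mat \<Rightarrow> complex mat \<Rightarrow> complex vec \<Rightarrow> complex \<Rightarrow> bool" where
  "gen_eigenvector A B v x \<longleftrightarrow>
    v \<in> carrier_vec (dim_row A) \<and> v \<noteq> 0\<^sub>v (dim_row A) \<and> A *\<^sub>v v = x \<cdot>\<^sub>v (B *\<^sub>v v)"

end

theory Submission
  imports Defs
begin

text \<open>
  With the prescribed \<open>h\<close>, row \<open>i\<close> of \<open>(\<G> - \<lambda>\<H>) (\<phi>\<^sub>0, \<phi>\<^sub>1, \<dots>)\<^sup>T = 0\<close> is the recurrence for \<open>r\<^sub>i\<^sub>+\<^sub>1\<close>
  divided by the denominator of \<open>\<phi>\<^sub>i\<close>. Truncation to the leading \<open>j \<times> j\<close> blocks drops only the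
  superdiagonal term of the last row, which is a multiple of \<open>r\<^sub>j(\<lambda>)\<close> and so vanishes at a zero of
  \<open>r\<^sub>j\<close>.
\<close>

lemma orf_den_0: "orf_den \<alpha> \<beta> 0 = 1"
  by (simp add: orf_den_def)

lemma poly_orf_den_odd:
  "poly (orf_den \<alpha> \<beta> (2*n+1)) z = (z - \<alpha> (n+1)) * poly (orf_den \<alpha> \<beta> (2*n)) z"
  by (simp add: orf_den_def algebra_simps)

lemma poly_orf_den_even:
  "poly (orf_den \<alpha> \<beta> (2*n+2)) z = (1 - z * cnj (\<beta> (n+1))) * poly (orf_den \<alpha> \<beta> (2*n+1)) z"
proof -
  \<comment> \<open>From index 2n+1 to 2n+2 the first product keeps its n+1 factors; only the second
    gains one, that of \<beta> at n+1.\<close>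
  have *: "(2*n+2+1) div 2 = n+1" "(2*n+2) div 2 = n+1" "(2*n+1+1) div 2 = n+1"
    "(2*n+1) div 2 = n"
    by simp_all
  show ?thesis
    unfolding orf_den_def * by (simp add: algebra_simps)
qed

text \<open>Evaluates one row of a truncated tridiagonal product. Row 0 has no left neighbour and
  row j-1 has lost its right one, hence the two conditionals.\<close>

lemma sum_tridiagonal:
  fixes f :: "nat \<Rightarrow> 'a::comm_monoid_add"
  assumes "i < j" and "\<And>k. k \<noteq> i \<Longrightarrow> k \<noteq> i + 1 \<Longrightarrow> i \<noteq> k + 1 \<Longrightarrow> f k = 0"
  shows "sum f {0..<j} =
    (if i = 0 then 0 else f (i - 1)) + f i + (if i + 1 < j then f (i + 1) else 0)"
proof -
  let ?S = "{k. k < j \<and> (k = i \<or> k = i + 1 \<or> i = k + 1)}"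
  have "sum f {0..<j} = sum f ?S"
    by (rule sum.mono_neutral_right) (use assms(2) in auto)
  also have "?S = (if i = 0 then {} else {i - 1}) \<union> {i} \<union> (if i + 1 < j then {i + 1} else {})"
    using assms(1) by auto
  also have "sum f \<dots> =
      (if i = 0 then 0 else f (i - 1)) + f i + (if i + 1 < j then f (i + 1) else 0)"
    by (auto simp: add.commute add.left_commute)
  finally show ?thesis .
qed

context orf_setting
begin

context
  fixes h :: "nat \<Rightarrow> complex"
  assumes h_even: "\<And>i. i \<ge> 1 \<Longrightarrow> h (2*i) = - c (2*i+1) * cnj (\<alpha> i)"
    and h_odd: "\<And>i. i \<ge> 1 \<Longrightarrow> h (2*i-1) = c (2*i)"
begin

text \<open>The prescribed \<open>h\<close> cancels the nonzero coefficient \<open>c\<close>. The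
  value -1 turns the superdiagonal entry of \<open>pencil\<close> into x - \<alpha>(n+1), the factor
  that \<open>orf_den\<close> gains there.\<close>

lemma pencil_g_odd: "pencil_g \<alpha> \<beta> c h (2*n+1) = -1"
  using h_odd[of "n+1"] c_nz[of "2*n+2"] by (simp add: pencil_g_def)

lemma pencil_g_even: "pencil_g \<alpha> \<beta> c h (2*n+2) = cnj (\<beta> (n+1))"
  using h_even[of "n+1"] c_nz[of "2*n+3"] alpha_nz[of "n+1"]
  by (simp add: pencil_g_def field_simps numeral_3_eq_3)

definition pencil :: "complex \<Rightarrow> nat \<Rightarrow> nat \<Rightarrow> complex" where
  "pencil x i k = pencil_G \<alpha> \<beta> e d c h i k - x * pencil_H \<alpha> \<beta> d c h i k"

text \<open>The entry is exactly the linear factor by which \<open>orf_den\<close> grows from i to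
  i+1, so it cancels and leaves the smaller denominator.\<close>

lemma pencil_superdiagonal:
  assumes "poly (orf_den \<alpha> \<beta> (i+1)) x \<noteq> 0"
  shows "pencil x i (i+1) * orf_eval \<alpha> \<beta> r (i+1) x
    = poly (r (i+1)) x / poly (orf_den \<alpha> \<beta> i) x"
proof (cases "even i")
  case True
  then obtain n where i: "i = 2*n" by blast
  have "pencil x i (i+1) = x - \<alpha> (n+1)"
    using pencil_g_odd[of n] by (simp add: pencil_def pencil_G_def pencil_H_def i)
  then show ?thesis
    using assms poly_orf_den_odd[of \<alpha> \<beta> n x] by (simp add: orf_eval_def i)
next
  case False
  then obtain n where i: "i = 2*n+1" by (auto elim: oddE)
  have "pencil x i (i+1) = 1 - x * cnj (\<beta> (n+1))"
    using pencil_g_even[of n] beta_nz[of "n+1"]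
    by (simp add: pencil_def pencil_G_def pencil_H_def i)
  then show ?thesis
    using assms poly_orf_den_even[of \<alpha> \<beta> n x] by (simp add: orf_eval_def i)
qed

text \<open>The last summand is the superdiagonal term after cancellation. In this form it stays
  meaningful when x is a zero of the denominator at i+1, which may happen in the last row.\<close>

lemma pencil_row:
  assumes den: "poly (orf_den \<alpha> \<beta> i) x \<noteq> 0"
  shows "(if i = 0 then 0 else pencil x i (i-1) * orf_eval \<alpha> \<beta> r (i-1) x)
    + pencil x i i * orf_eval \<alpha> \<beta> r i x
    + poly (r (i+1)) x / poly (orf_den \<alpha> \<beta> i) x = 0"
proof (cases "even i")
  case True
  then obtain n where i: "i = 2*n" by blast
  have diag: "pencil x i i = - (e (2*n+1) + d (2*n+1) * (x - \<beta> n))"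
    by (simp add: pencil_def pencil_G_def pencil_H_def i algebra_simps)
  show ?thesis
  proof (cases n)
    \<comment> \<open>Row 0 has no subdiagonal entry, matching the convention that the recurrence
      starts with r_{-1} = 0.\<close>
    case 0
    then show ?thesis
      using diag rec_odd[of 0 x] by (simp add: i orf_eval_def orf_den_0 r_0)
  next
    case (Suc m)
    have sub: "pencil x i (i-1) = - c (2*n+1) * (1 - x * cnj (\<alpha> n))"
      using h_even[of n] alpha_nz[of n]
      by (simp add: pencil_def pencil_G_def pencil_H_def i Suc algebra_simps)
    have D: "poly (orf_den \<alpha> \<beta> (2*n)) x
        = (1 - x * cnj (\<beta> n)) * poly (orf_den \<alpha> \<beta> (2*n-1)) x"
      using poly_orf_den_even[of \<alpha> \<beta> m x] by (simp add: Suc)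
    \<comment> \<open>Over the denominator at 2n, the numerator \<open>r (2*n-1)\<close> acquires
      the factor 1 - x cnj \<beta>(n), which together with \<open>sub\<close> restores the
      coefficient in \<open>rec_odd\<close>.\<close>
    have "poly (orf_den \<alpha> \<beta> (2*n-1)) x \<noteq> 0" "1 - x * cnj (\<beta> n) \<noteq> 0"
      using den D by (auto simp: i)
    then show ?thesis
      using Suc unfolding sub diag unfolding i orf_eval_def D rec_odd[of n x]
      by (simp add: divide_simps) (simp add: algebra_simps)
  qed
next
  case False
  then obtain n where i: "i = 2*n+1" by (auto elim: oddE)
  have diag: "pencil x i i = - (e (2*n+2) + d (2*n+2) * (1 - x * cnj (\<alpha> (n+1))))"
    by (simp add: pencil_def pencil_G_def pencil_H_def i algebra_simps)
  have sub: "pencil x i (i-1) = - c (2*n+2) * (x - \<beta> n)"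
    using h_odd[of "n+1"] by (simp add: pencil_def pencil_G_def pencil_H_def i algebra_simps)
  have R: "poly (r (2*n+1+1)) x =
        (e (2*n+2) + d (2*n+2) * (1 - x * cnj (\<alpha> (n+1)))) * poly (r (2*n+1)) x +
        c (2*n+2) * (x - \<alpha> (n+1)) * (x - \<beta> n) * poly (r (2*n)) x"
    using rec_even[of n x] by simp
  \<comment> \<open>Here the change of denominator supplies the factor x - \<alpha>(n+1) of
    \<open>rec_even\<close> that \<open>sub\<close> lacks.\<close>
  have "poly (orf_den \<alpha> \<beta> (2*n)) x \<noteq> 0" "x - \<alpha> (n+1) \<noteq> 0"
    using den poly_orf_den_odd[of \<alpha> \<beta> n x] by (auto simp: i)
  then show ?thesis
    unfolding sub diag unfolding i orf_eval_def poly_orf_den_odd R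
    by (simp add: divide_simps) (simp add: algebra_simps)
qed

lemma pencil_truncated_row:
  assumes root: "poly (r j) x = 0"
    and defined: "\<And>i. i < j \<Longrightarrow> poly (orf_den \<alpha> \<beta> i) x \<noteq> 0"
    and i: "i < j"
  shows "(\<Sum>k = 0..<j. pencil x i k * orf_eval \<alpha> \<beta> r k x) = 0"
proof -
  have "(\<Sum>k = 0..<j. pencil x i k * orf_eval \<alpha> \<beta> r k x)
    = (if i = 0 then 0 else pencil x i (i-1) * orf_eval \<alpha> \<beta> r (i-1) x)
      + pencil x i i * orf_eval \<alpha> \<beta> r i x
      + (if i + 1 < j then pencil x i (i+1) * orf_eval \<alpha> \<beta> r (i+1) x else 0)"
    using i by (rule sum_tridiagonal) (simp add: pencil_def pencil_G_def pencil_H_def)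
  also have "(if i + 1 < j then pencil x i (i+1) * orf_eval \<alpha> \<beta> r (i+1) x else 0)
      = poly (r (i+1)) x / poly (orf_den \<alpha> \<beta> i) x"
  proof (cases "i + 1 < j")
    case True
    then show ?thesis
      using pencil_superdiagonal[of i x] defined[of "i+1"] by simp
  next
    case False
    \<comment> \<open>In the last row the left side is 0 by truncation, the right side because x is
      a zero of \<open>r j\<close>.\<close>
    with i have "j = i + 1" by simp
    with root show ?thesis by simp
  qed
  also note pencil_row[OF defined[OF i]]
  finally show ?thesis .
qed

lemma gen_eigenvector_orf:
  assumes j: "j \<ge> 1"
    and root: "poly (r j) x = 0"
    and defined: "\<And>i. i < j \<Longrightarrow> poly (orf_den \<alpha> \<beta> i) x \<noteq> 0"
  shows "gen_eigenvector
      (leading_principal (pencil_G \<alpha> \<beta> e d c h) j)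
      (leading_principal (pencil_H \<alpha> \<beta> d c h) j)
      (vec j (\<lambda>i. orf_eval \<alpha> \<beta> r i x)) x"
  unfolding gen_eigenvector_def
proof (intro conjI)
  let ?v = "vec j (\<lambda>i. orf_eval \<alpha> \<beta> r i x)"
  let ?G = "leading_principal (pencil_G \<alpha> \<beta> e d c h) j"
  let ?H = "leading_principal (pencil_H \<alpha> \<beta> d c h) j"
  show "?v \<in> carrier_vec (dim_row ?G)"
    by (simp add: leading_principal_def)
  \<comment> \<open>The component \<phi>_0 is constantly 1, so the vector is nonzero for every
    x.\<close>
  have "?v $ 0 = 1"
    using j by (simp add: orf_eval_def orf_den_0 r_0)
  then show "?v \<noteq> 0\<^sub>v (dim_row ?G)"
    using j by (metis dim_row_mat(1) index_zero_vec(1) leading_principal_def less_eq_Suc_le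
        One_nat_def zero_neq_one)
  show "?G *\<^sub>v ?v = x \<cdot>\<^sub>v (?H *\<^sub>v ?v)"
  proof (rule eq_vecI)
    fix i
    assume "i < dim_vec (x \<cdot>\<^sub>v (?H *\<^sub>v ?v))"
    then have i: "i < j"
      by (simp add: leading_principal_def)
    show "(?G *\<^sub>v ?v) $ i = (x \<cdot>\<^sub>v (?H *\<^sub>v ?v)) $ i"
      using pencil_truncated_row[OF root defined i] i
      by (simp add: leading_principal_def scalar_prod_def pencil_def left_diff_distrib
          sum_subtractf sum_distrib_left mult.assoc)
  qed (simp add: leading_principal_def)
qed

end

end

theorem theorem2p2:
  fixes \<alpha> \<beta> :: "nat \<Rightarrow> complex"
    and L :: "ratfun \<Rightarrow> complex"
    and r :: "nat \<Rightarrow> complex poly"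
    and e d c h :: "nat \<Rightarrow> complex"
    and j :: nat
    and x :: complex
  assumes setting: "orf_setting \<alpha> \<beta> L r e d c"
    and h_even: "\<And>i. i \<ge> 1 \<Longrightarrow> h (2*i) = - c (2*i+1) * cnj (\<alpha> i)"
    and h_odd: "\<And>i. i \<ge> 1 \<Longrightarrow> h (2*i-1) = c (2*i)"
    and j: "j \<ge> 1"
    and root: "poly (r j) x = 0"
    and defined: "\<And>i. i < j \<Longrightarrow> poly (orf_den \<alpha> \<beta> i) x \<noteq> 0"
  shows "gen_eigenvector
      (leading_principal (pencil_G \<alpha> \<beta> e d c h) j)
      (leading_principal (pencil_H \<alpha> \<beta> d c h) j)
      (vec j (\<lambda>i. orf_eval \<alpha> \<beta> r i x)) x"
  using orf_setting.gen_eigenvector_orf[OF setting h_even h_odd j root defined] .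

end
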